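(* Let $h_7$ be a non-zero homogeneous harmonic polynomial of degree $7$ in $(x,y)$. 1) Let $\rho_8$ be a homogeneous $3$-harmonic polynomial of degree $8$ in $(x,y)$. Then $h_7 + \rho_8$ is $\mathcal{R}_8$-equivalent to $h_7$. 2) Let $\rho_9$ be a homogeneous $4$-harmonic polynomial of degree $9$ in $(x,y)$. Then $h_7 + \rho_9$ is $\mathcal{R}_9$-equivalent to $h_7$. 3) Let $\rho_{10}$ be a homogeneous $5$-harmonic polynomial of degree $10$ in $(x,y)$. Then $h_7 + \rho_{10}$ is $\mathcal{R}_{10}$-equivalent to $h_7$.
   Context: $\mathbf{R}^2$ has coordinates $(x,y)$ and $\Delta = \frac{\partial^2}{\partial x^2} + \frac{\partial^2}{\partial y^2}$ is the Laplacian. A function $h$ is harmonic if $\Delta h = 0$, and $l$-harmonic if $\Delta^l h = 0$. Functions are regarded as $C^\infty$ germs $(\mathbf{R}^2,\mathbf{0}) \to (\mathbf{R},0)$. Two germs $h_1,h_2$ are right-equivalent if there is a $C^\infty$ diffeomorphism-germ $\tau \colon (\mathbf{R}^2,\mathbf{0}) \to (\mathbf{R}^2,\mathbf{0})$ with $h_1 \circ \tau = h_2$. The $k$-jet $j^k h(\mathbf{0})$ is the Taylor series of $h$ at the origin up to and including degree $k$. Two germs $h_1, h_2$ are $\mathcal{R}_k$-equivalent if there is a germ $\tilde{h}_2$ with $j^k \tilde{h}_2(\mathbf{0}) = j^k h_2(\mathbf{0})$ such that $h_1$ is right-equivalent to $\tilde{h}_2$. *)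

theory Defs
  imports "HOL-Analysis.Analysis"
begin

definition partial_x :: "(real \<times> real \<Rightarrow> real) \<Rightarrow> real \<times> real \<Rightarrow> real" where
  "partial_x f = (\<lambda>(x, y). deriv (\<lambda>t. f (t, y)) x)"

definition partial_y :: "(real \<times> real \<Rightarrow> real) \<Rightarrow> real \<times> real \<Rightarrow> real" where
  "partial_y f = (\<lambda>(x, y). deriv (\<lambda>t. f (x, t)) y)"

definition laplacian :: "(real \<times> real \<Rightarrow> real) \<Rightarrow> real \<times> real \<Rightarrow> real" where
  "laplacian f = (\<lambda>p. partial_x (partial_x f) p + partial_y (partial_y f) p)"

definition harmonic :: "(real \<times> real \<Rightarrow> real) \<Rightarrow> bool" where
  "harmonic h \<longleftrightarrow> (\<forall>p. laplacian h p = 0)"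

definition polyharmonic :: "nat \<Rightarrow> (real \<times> real \<Rightarrow> real) \<Rightarrow> bool" where
  "polyharmonic l h \<longleftrightarrow> (\<forall>p. (laplacian ^^ l) h p = 0)"

text \<open>The zero polynomial counts as homogeneous of every degree.\<close>

definition homogeneous_polynomial :: "nat \<Rightarrow> (real \<times> real \<Rightarrow> real) \<Rightarrow> bool" where
  "homogeneous_polynomial n f \<longleftrightarrow>
     (\<exists>c. \<forall>x y. f (x, y) = (\<Sum>i\<le>n. c i * x ^ i * y ^ (n - i)))"

text \<open>
  For open \<open>S\<close>, \<open>Ck_on k S f\<close> says that \<open>f\<close> is of class \<open>C\<^sup>k\<close> on \<open>S\<close>: all iterated directional
  derivatives of order at most \<open>k\<close> exist (as values of Frechet derivatives) and are continuous.
\<close>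

primrec Ck_on ::
  "nat \<Rightarrow> 'a::real_normed_vector set \<Rightarrow> ('a \<Rightarrow> 'b::real_normed_vector) \<Rightarrow> bool" where
  "Ck_on 0 S f \<longleftrightarrow> continuous_on S f"
| "Ck_on (Suc k) S f \<longleftrightarrow>
     (\<forall>x\<in>S. f differentiable (at x)) \<and>
     (\<forall>v. Ck_on k S (\<lambda>x. frechet_derivative f (at x) v))"

definition smooth_on ::
  "'a::real_normed_vector set \<Rightarrow> ('a \<Rightarrow> 'b::real_normed_vector) \<Rightarrow> bool" where
  "smooth_on S f \<longleftrightarrow> (\<forall>k. Ck_on k S f)"

text \<open>
  Germs at the origin are represented by total functions, of which only the behaviour near \<open>0\<close>
  matters; equality of germs is equality eventually in \<open>nhds 0\<close>. All germs map \<open>0\<close> to \<open>0\<close>.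
\<close>

definition smooth_germ :: "('a::real_normed_vector \<Rightarrow> 'b::real_normed_vector) \<Rightarrow> bool" where
  "smooth_germ f \<longleftrightarrow> f 0 = 0 \<and> (\<exists>U. open U \<and> 0 \<in> U \<and> smooth_on U f)"

definition diffeo_germ :: "(real \<times> real \<Rightarrow> real \<times> real) \<Rightarrow> bool" where
  "diffeo_germ \<tau> \<longleftrightarrow> smooth_germ \<tau> \<and>
     (\<exists>\<sigma>. smooth_germ \<sigma> \<and>
        (\<forall>\<^sub>F p in nhds 0. \<sigma> (\<tau> p) = p) \<and> (\<forall>\<^sub>F p in nhds 0. \<tau> (\<sigma> p) = p))"

definition right_equivalent ::
  "(real \<times> real \<Rightarrow> real) \<Rightarrow> (real \<times> real \<Rightarrow> real) \<Rightarrow> bool" where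
  "right_equivalent h1 h2 \<longleftrightarrow> smooth_germ h1 \<and> smooth_germ h2 \<and>
     (\<exists>\<tau>. diffeo_germ \<tau> \<and> (\<forall>\<^sub>F p in nhds 0. h1 (\<tau> p) = h2 p))"

text \<open>
  The jet is the Taylor polynomial itself, as a function on the plane; two jets are equal iff the
  coefficients agree, since the reals are an infinite field.
\<close>

definition jet :: "nat \<Rightarrow> (real \<times> real \<Rightarrow> real) \<Rightarrow> real \<times> real \<Rightarrow> real" where
  "jet k h = (\<lambda>(x, y). \<Sum>(i, j) \<in> {(i, j). i + j \<le> k}.
     (partial_x ^^ i) ((partial_y ^^ j) h) (0, 0) / (fact i * fact j) * x ^ i * y ^ j)"

definition R_equivalent ::
  "nat \<Rightarrow> (real \<times> real \<Rightarrow> real) \<Rightarrow> (real \<times> real \<Rightarrow> real) \<Rightarrow> bool" where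
  "R_equivalent k h1 h2 \<longleftrightarrow> smooth_germ h1 \<and> smooth_germ h2 \<and>
     (\<exists>h2'. smooth_germ h2' \<and> jet k h2' = jet k h2 \<and> right_equivalent h1 h2')"

end

theory Submission
  imports Defs
begin

text \<open>
  Write \<open>z = x + i y\<close> and \<open>w\<close> for its conjugate. A harmonic \<open>h\<close> of degree \<open>n\<close> is \<open>Re (c z\<^sup>n)\<close>, and an
  \<open>l\<close>-harmonic form of degree \<open>d\<close> is the real part of a combination of the monomials
  \<open>z\<^bsup>d-j\<^esup> w\<^sup>j\<close> with \<open>j < l\<close>. Hence \<open>\<rho>\<close>, of degree \<open>n - 1 + k\<close> and \<open>(k + 1)\<close>-harmonic, equals
  \<open>- Re (n c z\<^bsup>n-1\<^esup> W)\<close> for a complex form \<open>W\<close> of degree \<open>k\<close>. The coordinate change \<open>z \<mapsto> z + W\<close>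
  turns \<open>h + \<rho>\<close> into \<open>h\<close> plus terms of degree at least \<open>n + k\<close>, provided \<open>k \<ge> 2\<close>. The three
  claims are the cases \<open>n = 7\<close> and \<open>k = 2, 3, 4\<close>.
\<close>

subsection \<open>Functions of class \<open>C\<^sup>k\<close>\<close>

text \<open>A derivative at a point of the open set \<open>S\<close> depends only on values nearby,
  so functions that agree on \<open>S\<close> have the same derivatives there.\<close>

lemma Ck_on_cong:
  assumes "open S" "\<And>x. x \<in> S \<Longrightarrow> f x = g x" "Ck_on k S f"
  shows "Ck_on k S g"
  using assms(2,3)
proof (induction k arbitrary: f g)
  case 0
  then show ?case
    by (metis Ck_on.simps(1) continuous_on_cong)
next
  case (Suc k)
  have d: "(g has_derivative frechet_derivative f (at x)) (at x)" if "x \<in> S" for x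
  proof (rule has_derivative_transform_within_open)
    show "(f has_derivative frechet_derivative f (at x)) (at x)"
      using Suc.prems(2) that by (simp add: frechet_derivative_works)
  qed (use assms(1) Suc.prems(1) that in auto)
  then have eq: "frechet_derivative f (at x) = frechet_derivative g (at x)" if "x \<in> S" for x
    using that frechet_derivative_at by blast
  have "Ck_on k S (\<lambda>x. frechet_derivative g (at x) v)" for v
    using Suc.IH[of "\<lambda>x. frechet_derivative f (at x) v" "\<lambda>x. frechet_derivative g (at x) v"] Suc.prems(2) eq
    by simp
  with d show ?case
    by (auto simp: differentiable_def)
qed

text \<open>Derivatives are unique, so an explicit formula \<open>D\<close> may replace
  \<open>frechet_derivative\<close>. The closure properties below feed it the usual differentiation
  rules, by induction on \<open>k\<close>.\<close>

lemma Ck_on_SucI: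
  assumes "open S" "\<And>x. x \<in> S \<Longrightarrow> (f has_derivative D x) (at x)"
    and "\<And>v. Ck_on k S (\<lambda>x. D x v)"
  shows "Ck_on (Suc k) S f"
proof -
  have eq: "D x = frechet_derivative f (at x)" if "x \<in> S" for x
    using assms(2)[OF that] frechet_derivative_at by blast
  have "Ck_on k S (\<lambda>x. frechet_derivative f (at x) v)" for v
    by (rule Ck_on_cong[OF assms(1) _ assms(3)]) (simp add: eq)
  with assms(2) show ?thesis
    by (auto simp: differentiable_def)
qed

lemma Ck_on_SucD: "Ck_on (Suc k) S f \<Longrightarrow> Ck_on k S f"
proof (induction k arbitrary: f)
  case 0
  then show ?case
    by (simp add: continuous_at_imp_continuous_on differentiable_imp_continuous_within)
qed simp

lemma Ck_on_const: "open S \<Longrightarrow> Ck_on k S (\<lambda>_. c)"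
proof (induction k arbitrary: c)
  case (Suc k)
  show ?case
    by (rule Ck_on_SucI[OF Suc.prems has_derivative_const Suc.IH[OF Suc.prems]])
qed simp

lemma Ck_on_bounded_linear:
  assumes "open S" "bounded_linear L"
  shows "Ck_on k S L"
proof (cases k)
  case 0
  then show ?thesis
    using assms(2) by (simp add: linear_continuous_on)
next
  case (Suc m)
  show ?thesis
    unfolding Suc
    by (rule Ck_on_SucI[OF assms(1) bounded_linear_imp_has_derivative[OF assms(2)] Ck_on_const[OF assms(1)]])
qed

lemma Ck_on_bounded_linear_compose:
  assumes "bounded_linear L" "open S" "Ck_on k S f"
  shows "Ck_on k S (\<lambda>x. L (f x))"
  using assms(3)
proof (induction k arbitrary: f)
  case 0
  then show ?case
    using assms(1) by (simp add: bounded_linear.continuous_on)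
next
  case (Suc k)
  show ?case
    by (rule Ck_on_SucI[OF assms(2), where D = "\<lambda>x v. L (frechet_derivative f (at x) v)"])
      (use Suc assms(1) in \<open>auto intro: bounded_linear.has_derivative simp: frechet_derivative_works\<close>)
qed

lemma Ck_on_Pair:
  assumes "open S" "Ck_on k S f" "Ck_on k S g"
  shows "Ck_on k S (\<lambda>x. (f x, g x))"
  using assms(2,3)
proof (induction k arbitrary: f g)
  case 0
  then show ?case by (simp add: continuous_on_Pair)
next
  case (Suc k)
  show ?case
    by (rule Ck_on_SucI[OF assms(1),
          where D = "\<lambda>x v. (frechet_derivative f (at x) v, frechet_derivative g (at x) v)"])
      (use Suc in \<open>auto intro: has_derivative_Pair simp: frechet_derivative_works\<close>)
qed

lemma Ck_on_add:
  assumes "open S" "Ck_on k S f" "Ck_on k S g"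
  shows "Ck_on k S (\<lambda>x. f x + g x)"
  using assms(2,3)
proof (induction k arbitrary: f g)
  case 0
  then show ?case by (simp add: continuous_on_add)
next
  case (Suc k)
  show ?case
    by (rule Ck_on_SucI[OF assms(1),
          where D = "\<lambda>x v. frechet_derivative f (at x) v + frechet_derivative g (at x) v"])
      (use Suc in \<open>auto intro: has_derivative_add simp: frechet_derivative_works\<close>)
qed

lemma Ck_on_mult:
  fixes f g :: "'a::real_normed_vector \<Rightarrow> real"
  assumes "open S" "Ck_on k S f" "Ck_on k S g"
  shows "Ck_on k S (\<lambda>x. f x * g x)"
  using assms(2,3)
proof (induction k arbitrary: f g)
  case 0
  then show ?case by (simp add: continuous_on_mult)
next
  case (Suc k)
  \<comment> \<open>The Leibniz formula contains \<open>f\<close> and \<open>g\<close>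
    undifferentiated, so they are also needed in class \<open>C^k\<close>.\<close>
  note low = Ck_on_SucD[OF Suc.prems(1)] Ck_on_SucD[OF Suc.prems(2)]
  show ?case
  proof (rule Ck_on_SucI[OF assms(1),
        where D = "\<lambda>x v. f x * frechet_derivative g (at x) v + frechet_derivative f (at x) v * g x"])
    show "((\<lambda>x. f x * g x) has_derivative
        (\<lambda>v. f x * frechet_derivative g (at x) v + frechet_derivative f (at x) v * g x)) (at x)"
      if "x \<in> S" for x
      using Suc.prems that by (intro has_derivative_mult) (simp_all add: frechet_derivative_works)
    show "Ck_on k S (\<lambda>x. f x * frechet_derivative g (at x) v + frechet_derivative f (at x) v * g x)" for v
      using Suc.prems by (intro Ck_on_add Suc.IH low assms(1)) simp_all
  qed
qed

lemma Ck_on_power: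
  fixes f :: "'a::real_normed_vector \<Rightarrow> real"
  assumes "open S" "Ck_on k S f"
  shows "Ck_on k S (\<lambda>x. f x ^ n)"
  by (induction n) (simp_all add: Ck_on_const Ck_on_mult assms)

text \<open>The derivative of \<open>1/f\<close> contains \<open>1/f\<close> again, but only its
  class \<open>C^k\<close> is required for the next step, and that is the induction hypothesis. It
  serves for the reciprocal of a Jacobian determinant.\<close>

lemma Ck_on_inverse:
  fixes f :: "'a::real_normed_vector \<Rightarrow> real"
  assumes "open S" "\<And>x. x \<in> S \<Longrightarrow> f x \<noteq> 0" "Ck_on k S f"
  shows "Ck_on k S (\<lambda>x. inverse (f x))"
  using assms(3)
proof (induction k)
  case 0
  then show ?case using assms(2) by (simp add: continuous_on_inverse)
next
  case (Suc k)
  note inv = Suc.IH[OF Ck_on_SucD[OF Suc.prems]]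
  show ?case
  proof (rule Ck_on_SucI[OF assms(1),
        where D = "\<lambda>x v. (-1) * (inverse (f x) * frechet_derivative f (at x) v * inverse (f x))"])
    fix x assume "x \<in> S"
    then have "(f has_derivative frechet_derivative f (at x)) (at x)"
      using Suc.prems by (simp add: frechet_derivative_works)
    from Deriv.has_derivative_inverse[OF assms(2)[OF \<open>x \<in> S\<close>] this]
    show "((\<lambda>x. inverse (f x)) has_derivative
        (\<lambda>v. (-1) * (inverse (f x) * frechet_derivative f (at x) v * inverse (f x)))) (at x)"
      by simp
  next
    fix v
    show "Ck_on k S (\<lambda>x. (-1) * (inverse (f x) * frechet_derivative f (at x) v * inverse (f x)))"
      by (intro Ck_on_mult assms(1) Ck_on_const inv) (use Suc.prems in simp)
  qed
qed

subsection \<open>Polynomials vanishing to a given order\<close>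

text \<open>The number \<open>m\<close> bounds the degree of every monomial from below: these are
  the polynomials in the \<open>m\<close>-th power of the maximal ideal at the origin, and for
  \<open>m = 0\<close> all polynomials. A lower bound, rather than the exact order, keeps sums and
  the zero function in the class.\<close>

inductive poly_ord :: "nat \<Rightarrow> (real \<times> real \<Rightarrow> real) \<Rightarrow> bool" where
  monom: "m \<le> a + b \<Longrightarrow> poly_ord m (\<lambda>p. c * fst p ^ a * snd p ^ b)"
| add: "poly_ord m f \<Longrightarrow> poly_ord m g \<Longrightarrow> poly_ord m (\<lambda>p. f p + g p)"

lemma poly_ord_0: "poly_ord m (\<lambda>_. 0)"
  using poly_ord.monom[of m m 0 0] by simp

lemma poly_ord_const: "poly_ord 0 (\<lambda>_. c)"
  using poly_ord.monom[of 0 0 0 c] by simp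

lemma poly_ord_fst: "poly_ord 1 fst"
  using poly_ord.monom[of 1 1 0 1] by simp

lemma poly_ord_snd: "poly_ord 1 snd"
  using poly_ord.monom[of 1 0 1 1] by simp

lemma poly_ord_mono: "poly_ord m f \<Longrightarrow> n \<le> m \<Longrightarrow> poly_ord n f"
  by (induction rule: poly_ord.induct) (auto intro: poly_ord.intros)

lemma poly_ord_cmult: "poly_ord m f \<Longrightarrow> poly_ord m (\<lambda>p. d * f p)"
proof (induction rule: poly_ord.induct)
  case (monom m a b c)
  then show ?case
    using poly_ord.monom[of m a b "d * c"] by (simp add: mult.assoc)
next
  case (add m f g)
  then show ?case
    by (simp add: distrib_left poly_ord.add)
qed

lemma poly_ord_diff: "poly_ord m f \<Longrightarrow> poly_ord m g \<Longrightarrow> poly_ord m (\<lambda>p. f p - g p)"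
  using poly_ord.add[OF _ poly_ord_cmult[of m g "-1"]] by simp

lemma poly_ord_mult: "poly_ord m f \<Longrightarrow> poly_ord n g \<Longrightarrow> poly_ord (m + n) (\<lambda>p. f p * g p)"
proof (induction rule: poly_ord.induct)
  case (monom m a b c)
  show ?case
    using monom(2,1)
  proof (induction rule: poly_ord.induct)
    case (monom n a' b' c')
    then show ?case
      using poly_ord.monom[of "m + n" "a + a'" "b + b'" "c * c'"]
      by (simp add: power_add mult_ac)
  next
    case (add n f g)
    then show ?case
      by (simp add: distrib_left poly_ord.add)
  qed
next
  case (add m f1 f2)
  then show ?case
    by (simp add: distrib_right poly_ord.add)
qed

lemma poly_ord_power: "poly_ord m f \<Longrightarrow> poly_ord (n * m) (\<lambda>p. f p ^ n)"
  by (induction n) (simp_all add: poly_ord_const poly_ord_mult)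

lemma poly_ord_sum: "(\<And>i. i \<in> I \<Longrightarrow> poly_ord m (f i)) \<Longrightarrow> poly_ord m (\<lambda>p. \<Sum>i\<in>I. f i p)"
  by (induction I rule: infinite_finite_induct) (simp_all add: poly_ord_0 poly_ord.add)

lemma poly_ord_at_0: "poly_ord m f \<Longrightarrow> 0 < m \<Longrightarrow> f 0 = 0"
  by (induction rule: poly_ord.induct) (auto simp: power_0_left)

text \<open>Meant for a local inverse of a polynomial map, which need not be polynomial itself: the
  entries of its derivative are built from polynomials evaluated along it.\<close>

lemma poly_ord_compose_Ck:
  assumes "poly_ord m f" "open S" "Ck_on k S u" "Ck_on k S v"
  shows "Ck_on k S (\<lambda>q. f (u q, v q))"
  using assms(1)
  by (induction rule: poly_ord.induct)
    (simp_all add: Ck_on_add Ck_on_mult Ck_on_power Ck_on_const assms(2-))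

lemma poly_ord_Ck: "poly_ord m f \<Longrightarrow> open S \<Longrightarrow> Ck_on k S f"
  using poly_ord_compose_Ck[of m f S k fst snd]
  by (simp add: Ck_on_bounded_linear bounded_linear_fst bounded_linear_snd)

section \<open>Partial derivatives and jets of polynomials\<close>

lemma poly_ord_has_derivative:
  assumes "poly_ord m f"
  shows "\<exists>fx fy. poly_ord (m - 1) fx \<and> poly_ord (m - 1) fy \<and>
      (\<forall>p. (f has_derivative (\<lambda>h. fx p * fst h + fy p * snd h)) (at p))"
    using assms
  proof (induction rule: poly_ord.induct)
    case (monom m a b c)
    \<comment> \<open>For \<open>a = 0\<close> the exponent \<open>a - 1\<close> is truncated, but
      then the coefficient \<open>c * a\<close> vanishes and the term is the zero function.\<close>
    have "poly_ord (m - 1) (\<lambda>p. (c * a) * fst p ^ (a - 1) * snd p ^ b)"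
      by (cases "a = 0") (use monom in \<open>auto intro!: poly_ord.monom poly_ord_0\<close>)
    moreover have "poly_ord (m - 1) (\<lambda>p. (c * b) * fst p ^ a * snd p ^ (b - 1))"
      by (cases "b = 0") (use monom in \<open>auto intro!: poly_ord.monom poly_ord_0\<close>)
    moreover have "((\<lambda>p. c * fst p ^ a * snd p ^ b) has_derivative
        (\<lambda>h. (c * a) * fst p ^ (a - 1) * snd p ^ b * fst h + (c * b) * fst p ^ a * snd p ^ (b - 1) * snd h)) (at p)"
      for p :: "real \<times> real"
      by (auto intro!: derivative_eq_intros simp: algebra_simps)
    ultimately show ?case by blast
  next
    case (add m f g)
    obtain fx fy where f: "poly_ord (m - 1) fx" "poly_ord (m - 1) fy"
      and df: "\<forall>p. (f has_derivative (\<lambda>h. fx p * fst h + fy p * snd h)) (at p)"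
      using add.IH(1) by (elim exE conjE)
    obtain gx gy where g: "poly_ord (m - 1) gx" "poly_ord (m - 1) gy"
      and dg: "\<forall>p. (g has_derivative (\<lambda>h. gx p * fst h + gy p * snd h)) (at p)"
      using add.IH(2) by (elim exE conjE)
    have "((\<lambda>p. f p + g p) has_derivative
        (\<lambda>h. (fx p + gx p) * fst h + (fy p + gy p) * snd h)) (at p)" for p
      using has_derivative_add[OF df[rule_format] dg[rule_format]] by (simp add: algebra_simps)
    with poly_ord.add[OF f(1) g(1)] poly_ord.add[OF f(2) g(2)] show ?case
      by (intro exI conjI allI)
  qed

text \<open>The total operator \<open>deriv\<close> is informative only where a derivative is known
  to exist; restricting the Frechet derivative to a horizontal line supplies one. Having it at every
  point gives an equality of functions, so partial derivatives can be iterated.\<close>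

lemma partial_x_eq:
  assumes "\<And>p. (f has_derivative (\<lambda>h. fx p * fst h + fy p * snd h)) (at p)"
  shows "partial_x f = fx"
proof (rule ext, clarify)
  fix x y :: real
  have "((\<lambda>t. (t, y)) has_derivative (\<lambda>h. (h, 0))) (at x)"
    by (auto intro!: derivative_eq_intros)
  from has_derivative_compose[OF this assms]
  have "((\<lambda>t. f (t, y)) has_derivative (\<lambda>h. fx (x, y) * h)) (at x)"
    by simp
  then show "partial_x f (x, y) = fx (x, y)"
    unfolding partial_x_def by (simp add: DERIV_imp_deriv has_field_derivative_def)
qed

lemma partial_y_eq:
  assumes "\<And>p. (f has_derivative (\<lambda>h. fx p * fst h + fy p * snd h)) (at p)"
  shows "partial_y f = fy"
proof (rule ext, clarify)
  fix x y :: real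
  have "((\<lambda>t. (x, t)) has_derivative (\<lambda>h. (0, h))) (at y)"
    by (auto intro!: derivative_eq_intros)
  from has_derivative_compose[OF this assms]
  have "((\<lambda>t. f (x, t)) has_derivative (\<lambda>h. fy (x, y) * h)) (at y)"
    by simp
  then show "partial_y f (x, y) = fy (x, y)"
    unfolding partial_y_def by (simp add: DERIV_imp_deriv has_field_derivative_def)
qed

lemma poly_ord_has_derivative_partial:
  assumes "poly_ord m f"
  shows "(f has_derivative (\<lambda>h. partial_x f p * fst h + partial_y f p * snd h)) (at p)"
proof -
  obtain fx fy where "poly_ord (m - 1) fx" "poly_ord (m - 1) fy"
    "\<forall>p. (f has_derivative (\<lambda>h. fx p * fst h + fy p * snd h)) (at p)"
    using poly_ord_has_derivative[OF assms] by (elim exE conjE)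
  with partial_x_eq[OF this(3)[rule_format]] partial_y_eq[OF this(3)[rule_format]] show ?thesis
    by (simp del: split_paired_All)
qed

lemma poly_ord_partial:
  assumes "poly_ord m f"
  shows "poly_ord (m - 1) (partial_x f)" "poly_ord (m - 1) (partial_y f)"
proof -
  obtain fx fy where "poly_ord (m - 1) fx" "poly_ord (m - 1) fy"
    "\<forall>p. (f has_derivative (\<lambda>h. fx p * fst h + fy p * snd h)) (at p)"
    using poly_ord_has_derivative[OF assms] by (elim exE conjE)
  with partial_x_eq[OF this(3)[rule_format]] partial_y_eq[OF this(3)[rule_format]]
  show "poly_ord (m - 1) (partial_x f)" "poly_ord (m - 1) (partial_y f)"
    by simp_all
qed

lemma partial_add:
  assumes "poly_ord m f" "poly_ord n g"
  shows "partial_x (\<lambda>p. f p + g p) = (\<lambda>p. partial_x f p + partial_x g p)"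
    and "partial_y (\<lambda>p. f p + g p) = (\<lambda>p. partial_y f p + partial_y g p)"
proof -
  have "((\<lambda>p. f p + g p) has_derivative (\<lambda>h. (partial_x f p + partial_x g p) * fst h +
      (partial_y f p + partial_y g p) * snd h)) (at p)" for p
    using has_derivative_add[OF poly_ord_has_derivative_partial[OF assms(1)]
        poly_ord_has_derivative_partial[OF assms(2)]]
    by (simp add: algebra_simps)
  from partial_x_eq[OF this] partial_y_eq[OF this]
  show "partial_x (\<lambda>p. f p + g p) = (\<lambda>p. partial_x f p + partial_x g p)"
    and "partial_y (\<lambda>p. f p + g p) = (\<lambda>p. partial_y f p + partial_y g p)" .
qed

lemma poly_ord_partial_funpow:
  assumes "poly_ord m f"
  shows "poly_ord (m - i) ((partial_x ^^ i) f)" "poly_ord (m - i) ((partial_y ^^ i) f)"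
proof (induction i)
  case (Suc i)
  { case 1 show ?case using poly_ord_partial(1)[OF Suc(1)] by simp }
  { case 2 show ?case using poly_ord_partial(2)[OF Suc(2)] by simp }
qed (use assms in simp_all)

lemma partial_funpow_add:
  assumes "poly_ord m f" "poly_ord n g"
  shows "(partial_x ^^ i) (\<lambda>p. f p + g p) = (\<lambda>p. (partial_x ^^ i) f p + (partial_x ^^ i) g p)"
    and "(partial_y ^^ i) (\<lambda>p. f p + g p) = (\<lambda>p. (partial_y ^^ i) f p + (partial_y ^^ i) g p)"
proof (induction i)
  case (Suc i)
  { case 1 show ?case
      using partial_add(1)[OF poly_ord_partial_funpow(1)[OF assms(1)] poly_ord_partial_funpow(1)[OF assms(2)]]
      by (simp add: Suc(1)) }
  { case 2 show ?case
      using partial_add(2)[OF poly_ord_partial_funpow(2)[OF assms(1)] poly_ord_partial_funpow(2)[OF assms(2)]]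
      by (simp add: Suc(2)) }
qed simp_all

text \<open>Each differentiation costs at most one order of vanishing, so a derivative of
  \<open>g\<close> of order at most \<open>k\<close> still vanishes to order
  \<open>n - k > 0\<close> and contributes nothing at the origin.\<close>

lemma jet_add_higher_order:
  assumes "poly_ord m f" "poly_ord n g" "k < n"
  shows "jet k (\<lambda>p. f p + g p) = jet k f"
proof -
  have "(partial_x ^^ i) ((partial_y ^^ j) (\<lambda>p. f p + g p)) (0, 0) =
      (partial_x ^^ i) ((partial_y ^^ j) f) (0, 0)" if "i + j \<le> k" for i j
  proof -
    have "poly_ord (n - j - i) ((partial_x ^^ i) ((partial_y ^^ j) g))"
      by (intro poly_ord_partial_funpow assms)
    then have "(partial_x ^^ i) ((partial_y ^^ j) g) (0, 0) = 0"
      using poly_ord_at_0[of "n - j - i"] that assms(3) by (simp add: zero_prod_def)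
    then show ?thesis
      by (simp add: partial_funpow_add[OF assms(1,2)] partial_funpow_add(1)[OF
            poly_ord_partial_funpow(2)[OF assms(1)] poly_ord_partial_funpow(2)[OF assms(2)]])
  qed
  then show ?thesis
    unfolding jet_def by (intro ext) (auto intro!: sum.cong)
qed

lemma poly_ord_smooth_germ: "poly_ord m f \<Longrightarrow> 0 < m \<Longrightarrow> smooth_germ f"
  unfolding smooth_germ_def smooth_on_def
  using poly_ord_at_0 poly_ord_Ck[of m f UNIV] open_UNIV by blast

subsection \<open>Polynomial diffeomorphism germs\<close>

text \<open>The inverse function theorem yields a local inverse that is differentiable once; its
  smoothness follows by bootstrapping from the formula for its derivative.\<close>

lemma diffeo_germ_polynomial_map:
  assumes f: "poly_ord 1 f" and g: "poly_ord 1 g"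
    and det0: "partial_x f 0 * partial_y g 0 - partial_y f 0 * partial_x g 0 \<noteq> 0"
  shows "diffeo_germ (\<lambda>p. (f p, g p))"
proof -
  define fx fy gx gy where "fx = partial_x f" "fy = partial_y f" "gx = partial_x g" "gy = partial_y g"
  note defs = this
  define det where "det = (\<lambda>p. fx p * gy p - fy p * gx p)"
  define D where "D = (\<lambda>p h. (fx p * fst h + fy p * snd h, gx p * fst h + gy p * snd h))"
  \<comment> \<open>Cramer's rule: \<open>E p\<close> is the inverse of \<open>D p\<close> wherever
    the determinant is nonzero, with entries rational in the coordinates.\<close>
  define E where "E = (\<lambda>p h. (inverse (det p) * (gy p * fst h + (- fy p) * snd h),
                              inverse (det p) * ((- gx p) * fst h + fx p * snd h)))"
  have ord: "poly_ord 0 fx" "poly_ord 0 fy" "poly_ord 0 gx" "poly_ord 0 gy"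
    using poly_ord_partial[OF f] poly_ord_partial[OF g] by (simp_all add: defs)
  have ord_det: "poly_ord 0 det"
    unfolding det_def using poly_ord_diff poly_ord_mult[of 0 _ 0] ord by simp
  have der: "((\<lambda>p. (f p, g p)) has_derivative D p) (at p)" for p
    unfolding D_def defs
    by (intro has_derivative_Pair poly_ord_has_derivative_partial[OF f]
        poly_ord_has_derivative_partial[OF g])
  then have blD: "bounded_linear (D p)" for p
    by (rule has_derivative_bounded_linear)
  have blE: "bounded_linear (E p)" for p
    unfolding E_def
    by (intro bounded_linear_Pair bounded_linear_add bounded_linear_const_mult
        bounded_linear_fst bounded_linear_snd)
  have ED: "E p (D p h) = h" "D p (E p h) = h" if "det p \<noteq> 0" for p h
  proof -
    have "gy p * (fx p * fst h + fy p * snd h) + (- fy p) * (gx p * fst h + gy p * snd h) = det p * fst h"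
      "(- gx p) * (fx p * fst h + fy p * snd h) + fx p * (gx p * fst h + gy p * snd h) = det p * snd h"
      by (simp_all add: det_def algebra_simps)
    with that show "E p (D p h) = h"
      by (simp add: E_def D_def prod_eq_iff del: minus_mult_left[symmetric])
    have "fx p * (i * (gy p * fst h + (- fy p) * snd h)) + fy p * (i * ((- gx p) * fst h + fx p * snd h))
        = i * det p * fst h"
      "gx p * (i * (gy p * fst h + (- fy p) * snd h)) + gy p * (i * ((- gx p) * fst h + fx p * snd h))
        = i * det p * snd h" for i
      by (simp_all add: det_def algebra_simps)
    from this[of "inverse (det p)"] that show "D p (E p h) = h"
      by (simp add: E_def D_def prod_eq_iff del: minus_mult_left[symmetric])
  qed
  have cont: "continuous_on UNIV P" if "poly_ord 0 P" for P
    using poly_ord_Ck[OF that, of UNIV 0] by simp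
  \<comment> \<open>The inverse function theorem is applied on the set of points with invertible
    Jacobian, so that the local inverse takes its values where \<open>E\<close> inverts
    \<open>D\<close>.\<close>
  define U where "U = {p. det p \<noteq> 0}"
  have "open U"
    unfolding U_def by (intro open_Collect_neq cont ord_det continuous_on_const)
  have apD: "blinfun_apply (Blinfun (D p)) = D p" for p
    using blD by (rule bounded_linear_Blinfun_apply)
  \<comment> \<open>In finite dimension, continuity in the operator norm can be checked on each
    basis vector.\<close>
  have contD: "continuous_on U (\<lambda>p. Blinfun (D p))"
  proof (rule continuous_on_blinfun_componentwise)
    fix i :: "real \<times> real"
    have "continuous_on UNIV (\<lambda>p. D p i)"
      unfolding D_def by (intro continuous_intros cont ord)
    then show "continuous_on U (\<lambda>p. blinfun_apply (Blinfun (D p)) i)"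
      unfolding apD by (rule continuous_on_subset) simp
  qed
  have "0 \<in> U"
    using det0 by (simp add: U_def det_def defs)
  have inv0: "Blinfun (E 0) o\<^sub>L Blinfun (D 0) = id_blinfun"
    using \<open>0 \<in> U\<close> by (intro blinfun_eqI) (simp add: apD bounded_linear_Blinfun_apply[OF blE] ED U_def)
  have derF: "((\<lambda>p. (f p, g p)) has_derivative blinfun_apply (Blinfun (D p))) (at p)" if "p \<in> U" for p
    unfolding apD by (rule der)
  have fg0: "f 0 = 0" "g 0 = 0"
    using poly_ord_at_0 f g by auto
  obtain U' V \<sigma> \<sigma>' where "open U'" "U' \<subseteq> U" "0 \<in> U'" "open V" "(f 0, g 0) \<in> V"
    and hom: "homeomorphism U' V (\<lambda>p. (f p, g p)) \<sigma>"
    and der\<sigma>: "\<And>y. y \<in> V \<Longrightarrow> (\<sigma> has_derivative (\<sigma>' y)) (at y)"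
    and \<sigma>': "\<And>y. y \<in> V \<Longrightarrow> \<sigma>' y = inv (blinfun_apply (Blinfun (D (\<sigma> y))))"
    using inverse_function_theorem[OF \<open>open U\<close> derF contD \<open>0 \<in> U\<close> inv0] by (metis (no_types, lifting))
  have "0 \<in> V"
    using \<open>(f 0, g 0) \<in> V\<close> fg0 by (simp add: zero_prod_def)
  have \<sigma>U: "\<sigma> y \<in> U" if "y \<in> V" for y
    using hom that \<open>U' \<subseteq> U\<close> by (auto simp: homeomorphism_def)
  \<comment> \<open>The abstract \<open>inv\<close> delivered by the inverse function theorem is
    replaced by the explicit \<open>E\<close>, which can be differentiated further.\<close>
  have der\<sigma>: "(\<sigma> has_derivative E (\<sigma> y)) (at y)" if "y \<in> V" for y
  proof -
    have "inv (D (\<sigma> y)) = E (\<sigma> y)"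
      using \<sigma>U[OF that] by (intro inv_unique_comp) (auto simp: ED U_def)
    then show ?thesis
      using der\<sigma>[OF that] \<sigma>'[OF that] by (simp add: apD)
  qed
  \<comment> \<open>Bootstrapping: the derivative \<open>E (\<sigma> y)\<close> is a rational
    expression in \<open>\<sigma>\<close>, so class \<open>C^k\<close> of \<open>\<sigma>\<close>
    gives class \<open>C^(k+1)\<close>. The start is the continuity contained in the
    homeomorphism.\<close>
  have "Ck_on k V \<sigma>" for k
  proof (induction k)
    case 0
    show ?case
      using hom by (simp add: homeomorphism_def)
  next
    case (Suc k)
    have comp: "Ck_on k V (\<lambda>y. P (\<sigma> y))" if "poly_ord 0 P" for P
      using poly_ord_compose_Ck[OF that \<open>open V\<close>, of k "\<lambda>y. fst (\<sigma> y)" "\<lambda>y. snd (\<sigma> y)"]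
        Ck_on_bounded_linear_compose[OF bounded_linear_fst \<open>open V\<close> Suc.IH]
        Ck_on_bounded_linear_compose[OF bounded_linear_snd \<open>open V\<close> Suc.IH]
      by simp
    have neg: "poly_ord 0 (\<lambda>p. - P p)" if "poly_ord 0 P" for P
      using poly_ord_cmult[OF that, of "-1"] by simp
    show ?case
    proof (rule Ck_on_SucI[OF \<open>open V\<close> der\<sigma>])
      show "Ck_on k V (\<lambda>y. E (\<sigma> y) h)" for h
        unfolding E_def
        by (intro Ck_on_Pair Ck_on_mult Ck_on_inverse Ck_on_add Ck_on_const \<open>open V\<close> comp neg ord ord_det)
          (use \<sigma>U in \<open>auto simp: U_def\<close>)
    qed
  qed
  moreover have "\<sigma> 0 = 0"
    using hom \<open>0 \<in> U'\<close> fg0 by (metis homeomorphism_apply1 zero_prod_def)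
  ultimately have "smooth_germ \<sigma>"
    using \<open>open V\<close> \<open>0 \<in> V\<close> by (auto simp: smooth_germ_def smooth_on_def)
  moreover have "smooth_germ (\<lambda>p. (f p, g p))"
    unfolding smooth_germ_def smooth_on_def
    using fg0 Ck_on_Pair[OF open_UNIV poly_ord_Ck[OF f open_UNIV] poly_ord_Ck[OF g open_UNIV]]
    by (auto simp: zero_prod_def)
  moreover have "\<forall>\<^sub>F p in nhds 0. \<sigma> (f p, g p) = p"
    using \<open>open U'\<close> \<open>0 \<in> U'\<close> homeomorphism_apply1[OF hom] by (auto simp: eventually_nhds)
  moreover have "\<forall>\<^sub>F p in nhds 0. (f (\<sigma> p), g (\<sigma> p)) = p"
    using \<open>open V\<close> \<open>0 \<in> V\<close> homeomorphism_apply2[OF hom] by (auto simp: eventually_nhds)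
  ultimately show ?thesis
    by (auto simp: diffeo_germ_def)
qed

subsection \<open>Polyharmonic homogeneous polynomials\<close>

text \<open>Exposes the coefficients that \<open>homogeneous_polynomial\<close> hides behind an
  existential, so that differentiation becomes an operation on coefficient sequences.\<close>

definition hpoly :: "nat \<Rightarrow> (nat \<Rightarrow> real) \<Rightarrow> real \<times> real \<Rightarrow> real" where
  "hpoly n c p = (\<Sum>i\<le>n. c i * fst p ^ i * snd p ^ (n - i))"

lemma homogeneous_polynomial_iff_hpoly: "homogeneous_polynomial n f \<longleftrightarrow> (\<exists>c. f = hpoly n c)"
  unfolding homogeneous_polynomial_def fun_eq_iff by (simp add: hpoly_def)

lemma poly_ord_hpoly: "poly_ord n (hpoly n c)"
  unfolding hpoly_def[abs_def] by (intro poly_ord_sum poly_ord.monom) simp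

lemma poly_ord_homogeneous: "homogeneous_polynomial n f \<Longrightarrow> poly_ord n f"
  by (auto simp: homogeneous_polynomial_iff_hpoly poly_ord_hpoly)

lemma homogeneous_polynomial_add:
  assumes "homogeneous_polynomial n f" "homogeneous_polynomial n g"
  shows "homogeneous_polynomial n (\<lambda>p. f p + g p)"
proof -
  obtain c d where "f = hpoly n c" "g = hpoly n d"
    using assms by (auto simp: homogeneous_polynomial_iff_hpoly)
  then have "(\<lambda>p. f p + g p) = hpoly n (\<lambda>i. c i + d i)"
    by (simp add: hpoly_def fun_eq_iff sum.distrib distrib_right)
  then show ?thesis
    by (auto simp: homogeneous_polynomial_iff_hpoly)
qed

lemma homogeneous_polynomial_sum:
  "(\<And>i. i \<in> I \<Longrightarrow> homogeneous_polynomial n (f i)) \<Longrightarrow> homogeneous_polynomial n (\<lambda>p. \<Sum>i\<in>I. f i p)"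
proof (induction I rule: infinite_finite_induct)
  case empty
  show ?case by (auto simp: homogeneous_polynomial_def intro!: exI[of _ "\<lambda>_. 0"])
next
  case (infinite I)
  then show ?case by (auto simp: homogeneous_polynomial_def intro!: exI[of _ "\<lambda>_. 0"])
qed (simp add: homogeneous_polynomial_add)

lemma homogeneous_polynomial_mult_fst:
  assumes "homogeneous_polynomial n f"
  shows "homogeneous_polynomial (Suc n) (\<lambda>p. fst p * f p)"
proof -
  obtain c where "f = hpoly n c"
    using assms by (auto simp: homogeneous_polynomial_iff_hpoly)
  \<comment> \<open>Multiplying by \<open>x\<close> shifts the coefficients up by one and puts 0 in
    front.\<close>
  then have "(\<lambda>p. fst p * f p) = hpoly (Suc n) (case_nat 0 c)"
    by (simp add: hpoly_def fun_eq_iff sum.atMost_Suc_shift sum_distrib_left mult_ac del: sum.atMost_Suc)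
  then show ?thesis
    by (auto simp: homogeneous_polynomial_iff_hpoly)
qed

lemma homogeneous_polynomial_mult_snd:
  assumes "homogeneous_polynomial n f"
  shows "homogeneous_polynomial (Suc n) (\<lambda>p. snd p * f p)"
proof -
  obtain c where "f = hpoly n c"
    using assms by (auto simp: homogeneous_polynomial_iff_hpoly)
  \<comment> \<open>The value \<open>c (Suc n)\<close> was arbitrary so far; as the new top
    coefficient it has to be 0.\<close>
  then have "(\<lambda>p. snd p * f p) = hpoly (Suc n) (c(Suc n := 0))"
    by (auto simp: hpoly_def fun_eq_iff sum_distrib_left Suc_diff_le mult_ac intro!: sum.cong)
  then show ?thesis
    by (auto simp: homogeneous_polynomial_iff_hpoly)
qed

lemma hpoly_partial:
  shows "partial_x (hpoly (Suc n) c) = hpoly n (\<lambda>i. real (Suc i) * c (Suc i))"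
    and "partial_y (hpoly (Suc n) c) = hpoly n (\<lambda>i. real (Suc n - i) * c i)"
proof -
  have "(hpoly (Suc n) c has_derivative
      (\<lambda>h. hpoly n (\<lambda>i. real (Suc i) * c (Suc i)) p * fst h +
           hpoly n (\<lambda>i. real (Suc n - i) * c i) p * snd h)) (at p)" for p
  proof -
    have "(hpoly (Suc n) c has_derivative
        (\<lambda>h. \<Sum>i\<le>Suc n. (c i * i * fst p ^ (i - 1) * snd p ^ (Suc n - i)) * fst h +
            (c i * (Suc n - i) * fst p ^ i * snd p ^ (Suc n - i - 1)) * snd h)) (at p)"
      unfolding hpoly_def[abs_def]
      by (rule has_derivative_sum) (auto intro!: derivative_eq_intros simp: algebra_simps)
    also have "(\<lambda>h. \<Sum>i\<le>Suc n. (c i * i * fst p ^ (i - 1) * snd p ^ (Suc n - i)) * fst h +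
            (c i * (Suc n - i) * fst p ^ i * snd p ^ (Suc n - i - 1)) * snd h) =
        (\<lambda>h. (\<Sum>i\<le>Suc n. c i * i * fst p ^ (i - 1) * snd p ^ (Suc n - i)) * fst h +
            (\<Sum>i\<le>Suc n. c i * (Suc n - i) * fst p ^ i * snd p ^ (Suc n - i - 1)) * snd h)"
      by (simp only: sum.distrib sum_distrib_right)
    \<comment> \<open>The summand for \<open>i = 0\<close> vanishes, and the index shifts by one; in
      the next sum the summand for \<open>i = Suc n\<close> vanishes instead.\<close>
    also have "(\<Sum>i\<le>Suc n. c i * i * fst p ^ (i - 1) * snd p ^ (Suc n - i)) =
        hpoly n (\<lambda>i. real (Suc i) * c (Suc i)) p"
      unfolding hpoly_def sum.atMost_Suc_shift by (simp add: mult_ac)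
    also have "(\<Sum>i\<le>Suc n. c i * (Suc n - i) * fst p ^ i * snd p ^ (Suc n - i - 1)) =
        hpoly n (\<lambda>i. real (Suc n - i) * c i) p"
      unfolding hpoly_def sum.atMost_Suc by (simp add: mult_ac)
    finally show ?thesis .
  qed
  from partial_x_eq[OF this] partial_y_eq[OF this]
  show "partial_x (hpoly (Suc n) c) = hpoly n (\<lambda>i. real (Suc i) * c (Suc i))"
    and "partial_y (hpoly (Suc n) c) = hpoly n (\<lambda>i. real (Suc n - i) * c i)" .
qed

lemma laplacian_hpoly:
  "laplacian (hpoly (Suc (Suc n)) c) =
     hpoly n (\<lambda>i. real (Suc i) * (real (Suc (Suc i)) * c (Suc (Suc i))) +
                 real (Suc n - i) * (real (Suc (Suc n) - i) * c i))"
  unfolding laplacian_def hpoly_partial by (simp add: hpoly_def fun_eq_iff sum.distrib distrib_right)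

text \<open>On the line \<open>y = 1\<close> the form becomes a polynomial in \<open>x\<close> with
  the same coefficients that vanishes identically.\<close>

lemma hpoly_eq_0D:
  assumes "\<And>p. hpoly n c p = 0" "i \<le> n"
  shows "c i = 0"
proof -
  have "\<forall>x. (\<Sum>i\<le>n. c i * x ^ i) = 0"
    using assms(1)[of "(_, 1)"] by (simp add: hpoly_def)
  with assms(2) show ?thesis
    by (simp add: polyfun_eq_0)
qed

lemma laplacian_add:
  assumes "poly_ord m f" "poly_ord n g"
  shows "laplacian (\<lambda>p. f p + g p) = (\<lambda>p. laplacian f p + laplacian g p)"
  unfolding laplacian_def partial_add[OF assms] partial_add(1)[OF poly_ord_partial(1)[OF assms(1)] poly_ord_partial(1)[OF assms(2)]]
    partial_add(2)[OF poly_ord_partial(2)[OF assms(1)] poly_ord_partial(2)[OF assms(2)]]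
  by (simp add: fun_eq_iff)

lemma laplacian_0: "laplacian (\<lambda>_. 0) = (\<lambda>_. 0)"
  by (simp add: laplacian_def partial_x_def partial_y_def fun_eq_iff)

lemma laplacian_sum:
  assumes "\<And>i. i \<in> I \<Longrightarrow> poly_ord m (f i)"
  shows "laplacian (\<lambda>p. \<Sum>i\<in>I. f i p) = (\<lambda>p. \<Sum>i\<in>I. laplacian (f i) p)"
  using assms
proof (induction I rule: infinite_finite_induct)
  case (insert i I)
  then show ?case
    using laplacian_add[of m "f i" m "\<lambda>p. \<Sum>i\<in>I. f i p"] by (simp add: poly_ord_sum)
qed (simp_all add: laplacian_0)

text \<open>The vanishing of the Laplacian is a two-step recurrence that expresses
  \<open>c (j + 2)\<close> by \<open>c j\<close>, with nonzero leading factor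
  \<open>(j + 1) (j + 2)\<close>. Two initial coefficients thus determine all others.\<close>

lemma harmonic_hpoly_eq_0:
  assumes "\<And>p. laplacian (hpoly n c) p = 0" "c 0 = 0" "c 1 = 0" "i \<le> n"
  shows "c i = 0"
  using assms(4)
proof (induction i rule: less_induct)
  case (less i)
  consider "i = 0" | "i = 1" | j where "i = Suc (Suc j)"
    by (metis One_nat_def not0_implies_Suc)
  then show ?case
  proof cases
    case 3
    then obtain m where n: "n = Suc (Suc m)" "j \<le> m"
      using less.prems by (metis Suc_le_D Suc_le_mono)
    have "real (Suc j) * (real (Suc (Suc j)) * c (Suc (Suc j))) +
        real (Suc m - j) * (real (Suc (Suc m) - j) * c j) = 0"
      using assms(1) hpoly_eq_0D[OF _ n(2)] unfolding n(1) laplacian_hpoly by blast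
    moreover have "c j = 0"
      using 3 less by simp
    ultimately show ?thesis
      using 3 by simp
  qed (use assms in simp_all)
qed

section \<open>Real parts of monomials in \<open>z\<close> and its conjugate, and the shape of
  polyharmonic forms\<close>

definition zpow :: "complex \<Rightarrow> nat \<Rightarrow> nat \<Rightarrow> real \<times> real \<Rightarrow> real" where
  "zpow a p q v = Re (a * (complex_of_real (fst v) + \<i> * complex_of_real (snd v)) ^ p
                        * (complex_of_real (fst v) - \<i> * complex_of_real (snd v)) ^ q)"

lemma zpow_0: "zpow 0 p q v = 0"
  by (simp add: zpow_def)

lemma zpow_uminus: "zpow (- a) p q v = - zpow a p q v"
  by (simp add: zpow_def)

text \<open>One factor is split off at a time:
  \<open>Re ((x + i y) A) = x Re A + y Re (i A)\<close>, so the \<open>y\<close>-part is again of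
  this shape with coefficient \<open>i a\<close>, and with \<open>- i a\<close> for a conjugate
  factor.\<close>

lemma homogeneous_polynomial_zpow: "homogeneous_polynomial (p + q) (zpow a p q)"
proof (induction p arbitrary: a)
  case 0
  show ?case
  proof (induction q arbitrary: a)
    case 0
    show ?case
      by (auto simp: homogeneous_polynomial_def zpow_def intro!: exI[of _ "\<lambda>_. Re a"])
  next
    case (Suc q)
    have "zpow a 0 (Suc q) = (\<lambda>v. fst v * zpow a 0 q v + snd v * zpow (- \<i> * a) 0 q v)"
      by (simp add: zpow_def fun_eq_iff algebra_simps)
    with Suc show ?case
      by (simp add: homogeneous_polynomial_add homogeneous_polynomial_mult_fst homogeneous_polynomial_mult_snd)
  qed
next
  case (Suc p)
  have "zpow a (Suc p) q = (\<lambda>v. fst v * zpow a p q v + snd v * zpow (\<i> * a) p q v)"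
    by (simp add: zpow_def fun_eq_iff algebra_simps)
  with Suc show ?case
    by (simp add: homogeneous_polynomial_add homogeneous_polynomial_mult_fst homogeneous_polynomial_mult_snd)
qed

lemma poly_ord_zpow: "poly_ord (p + q) (zpow a p q)"
  by (intro poly_ord_homogeneous homogeneous_polynomial_zpow)

text \<open>The chain rule, with \<open>z\<close> having partial derivatives 1 and \<open>i\<close>,
  and its conjugate 1 and \<open>- i\<close>. Where an exponent is truncated at 0, the factor
  \<open>of_nat p\<close> or \<open>of_nat q\<close> vanishes.\<close>

lemma zpow_partial:
  shows "partial_x (zpow a p q) = (\<lambda>v. zpow (of_nat p * a) (p - 1) q v + zpow (of_nat q * a) p (q - 1) v)"
    and "partial_y (zpow a p q) =
      (\<lambda>v. zpow (\<i> * of_nat p * a) (p - 1) q v + zpow (- \<i> * of_nat q * a) p (q - 1) v)"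
proof -
  have "(zpow a p q has_derivative
      (\<lambda>h. (zpow (of_nat p * a) (p - 1) q v + zpow (of_nat q * a) p (q - 1) v) * fst h +
        (zpow (\<i> * of_nat p * a) (p - 1) q v + zpow (- \<i> * of_nat q * a) p (q - 1) v) * snd h)) (at v)" for v
  proof -
    let ?z = "complex_of_real (fst v) + \<i> * complex_of_real (snd v)"
    let ?w = "complex_of_real (fst v) - \<i> * complex_of_real (snd v)"
    have "(zpow a p q has_derivative (\<lambda>h. Re (a * ?z ^ p *
          (of_nat q * (complex_of_real (fst h) - \<i> * complex_of_real (snd h)) * ?w ^ (q - 1)) +
        a * (of_nat p * (complex_of_real (fst h) + \<i> * complex_of_real (snd h)) * ?z ^ (p - 1)) * ?w ^ q))) (at v)"
      unfolding zpow_def[abs_def]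
      by (auto intro!: derivative_eq_intros)
    moreover have "Re (a * ?z ^ p * (of_nat q * (of_real s - \<i> * of_real t) * ?w ^ (q - 1)) +
        a * (of_nat p * (of_real s + \<i> * of_real t) * ?z ^ (p - 1)) * ?w ^ q) =
        (zpow (of_nat p * a) (p - 1) q v + zpow (of_nat q * a) p (q - 1) v) * s +
        (zpow (\<i> * of_nat p * a) (p - 1) q v + zpow (- \<i> * of_nat q * a) p (q - 1) v) * t" for s t
    proof -
      \<comment> \<open>Real factors move inside \<open>Re\<close>, so that the claim reduces to an
        identity of complex numbers.\<close>
      have r: "zpow b i j v * s = Re (of_real s * (b * ?z ^ i * ?w ^ j))" for b i j s
        by (simp add: zpow_def)
      show ?thesis
        unfolding distrib_right r plus_complex.sel(1)[symmetric]
        by (rule arg_cong[where f = Re]) (simp add: algebra_simps)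
    qed
    ultimately show ?thesis
      by simp
  qed
  from partial_x_eq[OF this] partial_y_eq[OF this]
  show "partial_x (zpow a p q) = (\<lambda>v. zpow (of_nat p * a) (p - 1) q v + zpow (of_nat q * a) p (q - 1) v)"
    and "partial_y (zpow a p q) =
      (\<lambda>v. zpow (\<i> * of_nat p * a) (p - 1) q v + zpow (- \<i> * of_nat q * a) p (q - 1) v)" .
qed

text \<open>This is the Laplacian written as four times the mixed derivative in \<open>z\<close> and
  its conjugate; the two unmixed second derivatives cancel because \<open>i^2 = -1\<close>.\<close>

lemma laplacian_zpow: "laplacian (zpow a p q) = zpow (4 * of_nat p * of_nat q * a) (p - 1) (q - 1)"
proof
  fix v
  have "laplacian (zpow a p q) v =
      zpow (of_nat (p - 1) * (of_nat p * a)) (p - 1 - 1) q v + zpow (of_nat q * (of_nat p * a)) (p - 1) (q - 1) v +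
      (zpow (of_nat p * (of_nat q * a)) (p - 1) (q - 1) v + zpow (of_nat (q - 1) * (of_nat q * a)) p (q - 1 - 1) v) +
      (zpow (\<i> * of_nat (p - 1) * (\<i> * of_nat p * a)) (p - 1 - 1) q v +
       zpow (- \<i> * of_nat q * (\<i> * of_nat p * a)) (p - 1) (q - 1) v +
       (zpow (\<i> * of_nat p * (- \<i> * of_nat q * a)) (p - 1) (q - 1) v +
        zpow (- \<i> * of_nat (q - 1) * (- \<i> * of_nat q * a)) p (q - 1 - 1) v))"
    unfolding laplacian_def zpow_partial partial_add[OF poly_ord_zpow poly_ord_zpow] ..
  also have "\<dots> = zpow (4 * of_nat p * of_nat q * a) (p - 1) (q - 1) v"
    by (simp add: zpow_def algebra_simps)
  finally show "laplacian (zpow a p q) v = zpow (4 * of_nat p * of_nat q * a) (p - 1) (q - 1) v" .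
qed

lemma harmonic_homogeneous_polynomial:
  assumes "homogeneous_polynomial n f" "\<And>p. laplacian f p = 0"
  obtains a where "f = zpow a n 0"
proof -
  obtain c where c: "f = hpoly n c"
    using assms by (auto simp: homogeneous_polynomial_iff_hpoly)
  show ?thesis
  proof (cases n)
    case 0
    then have "f = zpow (c 0) n 0"
      by (simp add: c fun_eq_iff hpoly_def zpow_def)
    then show ?thesis by (rule that)
  next
    case (Suc m)
    \<comment> \<open>Solves for the two initial coefficients of \<open>Re (a z^n)\<close>: its
      value at \<open>(0, 1)\<close> is \<open>Re (a i^n)\<close>, to equal \<open>c 0\<close>, and
      its \<open>x\<close>-derivative there is \<open>n Re (a i^m)\<close>, to equal
      \<open>c 1\<close>.\<close>
    define a where "a = (c 1 / real n - \<i> * c 0) / \<i> ^ m"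
    obtain d where d: "zpow a n 0 = hpoly n d"
      using homogeneous_polynomial_zpow[of n 0 a] by (auto simp: homogeneous_polynomial_iff_hpoly)
    have a: "a * \<i> ^ m = c 1 / real n - \<i> * c 0"
      by (simp add: a_def)
    have "d 0 = zpow a n 0 (0, 1)"
      unfolding d by (simp add: hpoly_def power_0_left sum.atMost_Suc_shift Suc del: sum.atMost_Suc)
    also have "\<dots> = c 0"
      using a by (simp add: zpow_def Suc mult_ac)
    finally have d0: "d 0 = c 0" .
    have "d 1 = partial_x (zpow a n 0) (0, 1)"
      unfolding d unfolding Suc hpoly_partial
      by (cases m) (simp_all add: hpoly_def power_0_left sum.atMost_Suc_shift del: sum.atMost_Suc)
    also have "\<dots> = Re (of_nat n * (a * \<i> ^ m))"
      by (simp add: zpow_partial zpow_def Suc algebra_simps)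
    also have "\<dots> = c 1"
      unfolding a by (simp add: Suc)
    finally have d1: "d 1 = c 1" .
    \<comment> \<open>The difference is harmonic with vanishing coefficients 0 and 1, hence zero by
      the recurrence.\<close>
    have diff: "hpoly n (\<lambda>i. c i - d i) = (\<lambda>p. f p + zpow (- a) n 0 p)"
      by (simp add: fun_eq_iff d c zpow_uminus) (simp add: hpoly_def sum_subtractf left_diff_distrib)
    have "laplacian (hpoly n (\<lambda>i. c i - d i)) p = 0" for p
      unfolding diff laplacian_add[OF poly_ord_homogeneous[OF assms(1)] poly_ord_zpow]
      by (simp add: assms(2) laplacian_zpow zpow_0)
    then have "c i = d i" if "i \<le> n" for i
      using harmonic_hpoly_eq_0[of n "\<lambda>i. c i - d i" i] d0 d1 that by simp
    then have "f = zpow a n 0"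
      unfolding c d by (simp add: hpoly_def fun_eq_iff)
    then show ?thesis by (rule that)
  qed
qed

lemma homogeneous_polynomial_laplacian:
  assumes "homogeneous_polynomial (Suc (Suc n)) f"
  shows "homogeneous_polynomial n (laplacian f)"
  using assms laplacian_hpoly by (auto simp: homogeneous_polynomial_iff_hpoly)

text \<open>Induction on \<open>l\<close>: the Laplacian of \<open>f\<close> has the required form
  in degree \<open>d - 2\<close>, its monomials are integrated one by one, and what remains of
  \<open>f\<close> is harmonic. The bound on \<open>l\<close> keeps the divisors of this integration
  nonzero.\<close>

lemma polyharmonic_homogeneous_polynomial:
  assumes "homogeneous_polynomial d f" "polyharmonic l f" "2 * l \<le> d + 2"
  shows "\<exists>a. \<forall>p. f p = (\<Sum>j<l. zpow (a j) (d - j) j p)"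
  using assms
proof (induction l arbitrary: d f)
  case 0
  then show ?case by (simp add: polyharmonic_def)
next
  case (Suc l)
  have pf: "poly_ord d f"
    using Suc.prems(1) by (rule poly_ord_homogeneous)
  have lap: "polyharmonic l (laplacian f)"
    using Suc.prems(2) by (simp add: polyharmonic_def funpow_Suc_right del: funpow.simps)
  \<comment> \<open>If \<open>l = 0\<close>, the degree may be below 2, so the induction hypothesis
    is not invoked: the Laplacian is zero and the sum is empty.\<close>
  obtain a where a: "\<And>p. laplacian f p = (\<Sum>j<l. zpow (a j) (d - 2 - j) j p)"
  proof (cases "l = 0")
    case True
    with lap show ?thesis by (intro that) (simp add: polyharmonic_def del: split_paired_All)
  next
    case False
    then have "d = Suc (Suc (d - 2))"
      using Suc.prems(3) by simp
    then obtain e where e: "d = Suc (Suc e)" ..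
    have "\<exists>a. \<forall>p. laplacian f p = (\<Sum>j<l. zpow (a j) (e - j) j p)"
      using Suc.prems lap by (intro Suc.IH) (simp_all add: e homogeneous_polynomial_laplacian)
    then obtain a where "\<And>p. laplacian f p = (\<Sum>j<l. zpow (a j) (e - j) j p)"
      by blast
    then show ?thesis
      by (intro that) (simp add: e)
  qed
  \<comment> \<open>The divisor is the factor that the Laplacian produces on the monomial with
    exponents \<open>d - 1 - j\<close> and \<open>j + 1\<close>. The minus sign in
    \<open>\<sigma>\<close> makes \<open>f + \<sigma>\<close> harmonic.\<close>
  define b where "b j = a j / of_nat (4 * (d - 1 - j) * Suc j)" for j
  define \<sigma> where "\<sigma> p = (\<Sum>j<l. zpow (- b j) (d - 1 - j) (Suc j) p)" for p
  have j: "d - 1 - j + Suc j = d" "d - 1 - j \<noteq> 0" if "j < l" for j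
    using that Suc.prems(3) by auto
  have hom: "homogeneous_polynomial d (zpow c (d - 1 - j) (Suc j))" if "j < l" for c j
    using homogeneous_polynomial_zpow[of "d - 1 - j" "Suc j" c] unfolding j(1)[OF that] .
  have hom\<sigma>: "homogeneous_polynomial d \<sigma>"
    unfolding \<sigma>_def[abs_def] by (intro homogeneous_polynomial_sum hom) simp
  have "laplacian \<sigma> p = - laplacian f p" for p
  proof -
    have "laplacian \<sigma> p = (\<Sum>j<l. laplacian (zpow (- b j) (d - 1 - j) (Suc j)) p)"
      unfolding \<sigma>_def[abs_def]
      by (rule fun_cong[OF laplacian_sum]) (rule poly_ord_homogeneous[OF hom], simp)
    also have "\<dots> = (\<Sum>j<l. - zpow (a j) (d - 2 - j) j p)"
    proof (rule sum.cong)
      fix i assume "i \<in> {..<l}"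
      define N where "N = complex_of_nat (4 * (d - 1 - i) * Suc i)"
      have "4 * (d - 1 - i) * Suc i \<noteq> 0"
        using j(2)[of i] \<open>i \<in> {..<l}\<close> by simp
      then have "N \<noteq> 0"
        unfolding N_def of_nat_eq_0_iff .
      moreover have "4 * of_nat (d - 1 - i) * of_nat (Suc i) = N"
        unfolding N_def of_nat_mult by simp
      ultimately have "4 * of_nat (d - 1 - i) * of_nat (Suc i) * (- b i) = - a i"
        by (simp only: b_def flip: N_def) simp
      then show "laplacian (zpow (- b i) (d - 1 - i) (Suc i)) p = - zpow (a i) (d - 2 - i) i p"
        unfolding laplacian_zpow by (simp add: zpow_uminus numeral_2_eq_2)
    qed simp
    finally show ?thesis
      by (simp add: a sum_negf)
  qed
  then have "laplacian (\<lambda>p. f p + \<sigma> p) p = 0" for p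
    by (simp add: laplacian_add[OF pf poly_ord_homogeneous[OF hom\<sigma>]])
  then obtain c where c: "(\<lambda>p. f p + \<sigma> p) = zpow c d 0"
    using harmonic_homogeneous_polynomial[OF homogeneous_polynomial_add[OF Suc.prems(1) hom\<sigma>]] by blast
  \<comment> \<open>The harmonic remainder supplies the term \<open>j = 0\<close>; the integrated
    terms move up by one index.\<close>
  have "f p = (\<Sum>j<Suc l. zpow (case_nat c b j) (d - j) j p)" for p
  proof -
    have "f p = zpow c d 0 p - \<sigma> p"
      using fun_cong[OF c, of p] by simp
    also have "- \<sigma> p = (\<Sum>j<l. zpow (b j) (d - 1 - j) (Suc j) p)"
      by (simp add: \<sigma>_def zpow_uminus sum_negf)
    ultimately show ?thesis
      unfolding sum.lessThan_Suc_shift by simp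
  qed
  then show ?case by blast
qed

subsection \<open>Removing the polyharmonic term\<close>

text \<open>Each term of the difference has at least one linear factor replaced by \<open>u\<close>
  or \<open>v\<close>, a gain of \<open>k - 1\<close> orders.\<close>

lemma poly_ord_translate_diff:
  assumes "poly_ord m f" and u: "poly_ord k u" and v: "poly_ord k v" and "1 \<le> k"
  shows "poly_ord (m + k - 1) (\<lambda>p. f (fst p + u p, snd p + v p) - f p)"
proof -
  have pow: "poly_ord (a + k - 1) (\<lambda>p. (s p + t p) ^ a - s p ^ a)"
    if s: "poly_ord 1 s" and t: "poly_ord k t" for s t a
  proof (induction a)
    case 0
    show ?case by (simp add: poly_ord_0)
  next
    case (Suc a)
    have "(\<lambda>p. (s p + t p) ^ Suc a - s p ^ Suc a) =
        (\<lambda>p. (s p + t p) * ((s p + t p) ^ a - s p ^ a) + s p ^ a * t p)"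
      by (simp add: fun_eq_iff algebra_simps)
    moreover have "poly_ord (1 + (a + k - 1)) (\<lambda>p. (s p + t p) * ((s p + t p) ^ a - s p ^ a))"
      using s t \<open>1 \<le> k\<close> by (intro poly_ord_mult poly_ord.add Suc) (auto intro: poly_ord_mono)
    moreover have "poly_ord (a * 1 + k) (\<lambda>p. s p ^ a * t p)"
      by (intro poly_ord_mult poly_ord_power s t)
    ultimately show ?case
      using \<open>1 \<le> k\<close> by (simp add: poly_ord.add)
  qed
  show ?thesis
    using assms(1)
  proof (induction rule: poly_ord.induct)
    case (monom m a b c)
    have shift: "poly_ord 1 (\<lambda>p. snd p + v p)"
      using v \<open>1 \<le> k\<close> poly_ord_snd by (intro poly_ord.add) (auto intro: poly_ord_mono)
    \<comment> \<open>The displacement is carried out in \<open>x\<close> first and then in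
      \<open>y\<close>, which splits the difference of products into two summands.\<close>
    have "poly_ord (a + k - 1 + b * 1) (\<lambda>p. ((fst p + u p) ^ a - fst p ^ a) * (snd p + v p) ^ b)"
      by (intro poly_ord_mult pow poly_ord_power poly_ord_fst u shift)
    moreover have "poly_ord (a * 1 + (b + k - 1)) (\<lambda>p. fst p ^ a * ((snd p + v p) ^ b - snd p ^ b))"
      by (intro poly_ord_mult pow poly_ord_power poly_ord_fst poly_ord_snd v)
    ultimately have "poly_ord (a + b + k - 1) (\<lambda>p. ((fst p + u p) ^ a - fst p ^ a) * (snd p + v p) ^ b +
        fst p ^ a * ((snd p + v p) ^ b - snd p ^ b))"
      using \<open>1 \<le> k\<close> by (intro poly_ord.add) (auto elim: poly_ord_mono)
    then have "poly_ord (m + k - 1) (\<lambda>p. c * (((fst p + u p) ^ a - fst p ^ a) * (snd p + v p) ^ b +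
        fst p ^ a * ((snd p + v p) ^ b - snd p ^ b)))"
      using monom by (intro poly_ord_cmult) (auto elim: poly_ord_mono)
    then show ?case
      by (simp add: algebra_simps)
  next
    case (add m f g)
    then show ?case
      using poly_ord.add[OF add.IH] by (simp add: algebra_simps)
  qed
qed

section \<open>Complex-valued polynomials vanishing to a given order\<close>

definition cpoly_ord :: "nat \<Rightarrow> (real \<times> real \<Rightarrow> complex) \<Rightarrow> bool" where
  "cpoly_ord m F \<longleftrightarrow> poly_ord m (\<lambda>p. Re (F p)) \<and> poly_ord m (\<lambda>p. Im (F p))"

lemma cpoly_ord_add: "cpoly_ord m F \<Longrightarrow> cpoly_ord m G \<Longrightarrow> cpoly_ord m (\<lambda>p. F p + G p)"
  by (simp add: cpoly_ord_def poly_ord.add)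

lemma cpoly_ord_mult: "cpoly_ord m F \<Longrightarrow> cpoly_ord n G \<Longrightarrow> cpoly_ord (m + n) (\<lambda>p. F p * G p)"
  by (simp add: cpoly_ord_def poly_ord.add poly_ord_diff poly_ord_mult)

lemma cpoly_ord_mono: "cpoly_ord m F \<Longrightarrow> n \<le> m \<Longrightarrow> cpoly_ord n F"
  by (auto simp: cpoly_ord_def intro: poly_ord_mono)

lemma cpoly_ord_const: "cpoly_ord 0 (\<lambda>_. a)"
  by (simp add: cpoly_ord_def poly_ord_const)

lemma cpoly_ord_power: "cpoly_ord m F \<Longrightarrow> cpoly_ord (n * m) (\<lambda>p. F p ^ n)"
  by (induction n) (simp_all add: cpoly_ord_const cpoly_ord_mult)

lemma cpoly_ord_sum: "(\<And>i. i \<in> I \<Longrightarrow> cpoly_ord m (F i)) \<Longrightarrow> cpoly_ord m (\<lambda>p. \<Sum>i\<in>I. F i p)"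
  by (simp add: cpoly_ord_def poly_ord_sum)

text \<open>Beyond the linear term of the binomial expansion, every term has at least two factors
  \<open>W\<close>, of order \<open>2 k\<close> together, and the other \<open>n - 2\<close> factors
  have order at least 1.\<close>

lemma cpoly_ord_power_add_remainder:
  assumes F: "cpoly_ord 1 F" and W: "cpoly_ord k W" and "1 \<le> k"
  shows "cpoly_ord (n + 2 * k - 2) (\<lambda>p. (F p + W p) ^ n - F p ^ n - of_nat n * F p ^ (n - 1) * W p)"
proof (induction n)
  case 0
  show ?case by (simp add: cpoly_ord_def poly_ord_0)
next
  case (Suc n)
  \<comment> \<open>The remainders satisfy
    \<open>R (n + 1) = (F + W) R n + n F^(n-1) W^2\<close>.\<close>
  have "(\<lambda>p. (F p + W p) ^ Suc n - F p ^ Suc n - of_nat (Suc n) * F p ^ (Suc n - 1) * W p) =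
    (\<lambda>p. (F p + W p) * ((F p + W p) ^ n - F p ^ n - of_nat n * F p ^ (n - 1) * W p) +
      of_nat n * (F p ^ (n - 1) * (W p * W p)))"
    by (cases n) (simp_all add: fun_eq_iff algebra_simps)
  moreover have "cpoly_ord (Suc n + 2 * k - 2)
      (\<lambda>p. (F p + W p) * ((F p + W p) ^ n - F p ^ n - of_nat n * F p ^ (n - 1) * W p))"
  proof -
    have "cpoly_ord (1 + (n + 2 * k - 2))
        (\<lambda>p. (F p + W p) * ((F p + W p) ^ n - F p ^ n - of_nat n * F p ^ (n - 1) * W p))"
      using F W \<open>1 \<le> k\<close> by (intro cpoly_ord_mult cpoly_ord_add Suc) (auto intro: cpoly_ord_mono)
    then show ?thesis
      using \<open>1 \<le> k\<close> by (auto elim: cpoly_ord_mono)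
  qed
  moreover have "cpoly_ord (Suc n + 2 * k - 2) (\<lambda>p. of_nat n * (F p ^ (n - 1) * (W p * W p)))"
  proof -
    have "cpoly_ord (0 + ((n - 1) * 1 + (k + k))) (\<lambda>p. of_nat n * (F p ^ (n - 1) * (W p * W p)))"
      by (intro cpoly_ord_mult cpoly_ord_const cpoly_ord_power F W)
    then show ?thesis
      by (rule cpoly_ord_mono) linarith
  qed
  ultimately show ?case
    by (simp only: cpoly_ord_add)
qed

text \<open>The bound \<open>k + 1 \<le> n\<close> is the degree condition for expanding
  \<open>\<rho>\<close> in monomials; \<open>2 \<le> k\<close> makes the coordinate change tangent
  to the identity and the errors of order at least \<open>n + k\<close>.\<close>

theorem R_equivalent_harmonic_add_polyharmonic:
  assumes h: "homogeneous_polynomial n h" "h \<noteq> (\<lambda>_. 0)" "harmonic h"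
    and \<rho>: "homogeneous_polynomial (n - 1 + k) \<rho>" "polyharmonic (k + 1) \<rho>"
    and k: "2 \<le> k" "k + 1 \<le> n"
  shows "R_equivalent (n - 1 + k) (\<lambda>p. h p + \<rho> p) h"
proof -
  define Z where "Z p = complex_of_real (fst p) + \<i> * complex_of_real (snd p)" for p
  define Z' where "Z' p = complex_of_real (fst p) - \<i> * complex_of_real (snd p)" for p
  have zp: "zpow a i j p = Re (a * Z p ^ i * Z' p ^ j)" for a i j p
    by (simp add: zpow_def Z_def Z'_def)
  obtain c where c: "h = zpow c n 0"
    using harmonic_homogeneous_polynomial[of n h] h unfolding harmonic_def by metis
  have "c \<noteq> 0"
    using h(2) zpow_0[of n 0] unfolding c by auto
  obtain a where a: "\<And>p. \<rho> p = (\<Sum>j<k + 1. zpow (a j) (n - 1 + k - j) j p)"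
    using polyharmonic_homogeneous_polynomial[OF \<rho>] k by auto
  \<comment> \<open>Solves \<open>n c b j = - a j\<close>; the division is possible because
    \<open>h\<close> is nonzero.\<close>
  define b where "b j = - a j / (of_nat n * c)" for j
  define W where "W p = (\<Sum>j<k + 1. b j * Z p ^ (k - j) * Z' p ^ j)" for p
  define u where "u p = Re (W p)" for p
  define v where "v p = Im (W p)" for p
  have Z: "cpoly_ord 1 Z" and Z': "cpoly_ord 1 Z'"
    using poly_ord_fst poly_ord_snd poly_ord_cmult[OF poly_ord_snd, of "-1"]
    by (simp_all add: cpoly_ord_def Z_def[abs_def] Z'_def[abs_def])
  have W: "cpoly_ord k W"
  proof -
    have "cpoly_ord k (\<lambda>p. b j * Z p ^ (k - j) * Z' p ^ j)" if "j < k + 1" for j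
    proof -
      have "cpoly_ord (0 + (k - j) * 1 + j * 1) (\<lambda>p. b j * Z p ^ (k - j) * Z' p ^ j)"
        by (intro cpoly_ord_mult cpoly_ord_power cpoly_ord_const Z Z')
      with that show ?thesis by simp
    qed
    then show ?thesis
      unfolding W_def[abs_def] by (intro cpoly_ord_sum) simp
  qed
  have uv: "poly_ord k u" "poly_ord k v"
    using W by (simp_all add: cpoly_ord_def u_def[abs_def] v_def[abs_def])
  define \<tau> where "\<tau> p = (fst p + u p, snd p + v p)" for p
  have ZW: "Z (\<tau> p) = Z p + W p" for p
    by (simp add: Z_def \<tau>_def u_def v_def complex_eq_iff)
  text \<open>The linear term of \<open>h \<circ> \<tau>\<close> cancels \<open>\<rho>\<close> because every term of \<open>\<rho>\<close> contains the factor \<open>z ^ (n - 1)\<close>.\<close>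
  have cancel: "Re (c * (of_nat n * Z p ^ (n - 1) * W p)) = - \<rho> p" for p
  proof -
    have "c * (of_nat n * Z p ^ (n - 1) * W p) = (\<Sum>j<k + 1. - (a j * Z p ^ (n - 1 + k - j) * Z' p ^ j))"
      unfolding W_def sum_distrib_left
    proof (rule sum.cong)
      fix j assume "j \<in> {..<k + 1}"
      then have exp: "n - 1 + k - j = (n - 1) + (k - j)"
        by auto
      have "of_nat n * c * b j = - a j"
        using \<open>c \<noteq> 0\<close> k by (simp add: b_def)
      moreover have "c * (of_nat n * Z p ^ (n - 1) * (b j * Z p ^ (k - j) * Z' p ^ j)) =
          (of_nat n * c * b j) * Z p ^ (n - 1 + k - j) * Z' p ^ j"
        unfolding exp power_add by (simp only: mult_ac)
      ultimately show "c * (of_nat n * Z p ^ (n - 1) * (b j * Z p ^ (k - j) * Z' p ^ j)) =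
          - (a j * Z p ^ (n - 1 + k - j) * Z' p ^ j)"
        by (simp only: mult_minus_left)
    qed simp
    then show ?thesis
      by (simp add: a zp sum_negf del: sum.lessThan_Suc)
  qed
  define R where "R p = (Z p + W p) ^ n - Z p ^ n - of_nat n * Z p ^ (n - 1) * W p" for p
  \<comment> \<open>The total error: the part of \<open>h \<circ> \<tau>\<close> beyond the linear
    term, and the change of \<open>\<rho>\<close> under \<open>\<tau>\<close>. Both have order
    \<open>n + 2 k - 2\<close>, which is at least \<open>n + k\<close>.\<close>
  define r where "r p = Re (c * R p) + (\<rho> (\<tau> p) - \<rho> p)" for p
  have comp: "h (\<tau> p) + \<rho> (\<tau> p) = h p + r p" for p
  proof -
    have "c * (Z p + W p) ^ n = c * Z p ^ n + c * (of_nat n * Z p ^ (n - 1) * W p) + c * R p"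
      by (simp add: R_def algebra_simps)
    from arg_cong[OF this, of Re] cancel[of p] show ?thesis
      by (simp add: c zp ZW r_def del: times_complex.sel)
  qed
  have "cpoly_ord (0 + (n + 2 * k - 2)) (\<lambda>p. c * R p)"
    unfolding R_def using k
    by (intro cpoly_ord_mult cpoly_ord_const cpoly_ord_power_add_remainder Z W) simp
  then have "poly_ord (n + k) (\<lambda>p. Re (c * R p))"
    using k unfolding cpoly_ord_def by (auto elim: poly_ord_mono simp del: times_complex.sel)
  moreover have "poly_ord (n + k) (\<lambda>p. \<rho> (\<tau> p) - \<rho> p)"
    using poly_ord_translate_diff[OF poly_ord_homogeneous[OF \<rho>(1)] uv] k
    unfolding \<tau>_def by (auto elim: poly_ord_mono)
  ultimately have r: "poly_ord (n + k) r"
    unfolding r_def[abs_def] by (rule poly_ord.add)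
  have ph: "poly_ord n h" and p\<rho>: "poly_ord (n - 1 + k) \<rho>"
    using h(1) \<rho>(1) by (simp_all add: poly_ord_homogeneous)
  have smooth: "smooth_germ h" "smooth_germ (\<lambda>p. h p + \<rho> p)" "smooth_germ (\<lambda>p. h p + r p)"
  proof -
    have "poly_ord n (\<lambda>p. h p + \<rho> p)" "poly_ord n (\<lambda>p. h p + r p)"
      using ph p\<rho> r k by (auto intro!: poly_ord.add elim: poly_ord_mono)
    with ph k show "smooth_germ h" "smooth_germ (\<lambda>p. h p + \<rho> p)" "smooth_germ (\<lambda>p. h p + r p)"
      by (auto intro: poly_ord_smooth_germ)
  qed
  have "diffeo_germ \<tau>"
    unfolding \<tau>_def[abs_def]
  proof (rule diffeo_germ_polynomial_map)
    show "poly_ord 1 (\<lambda>p. fst p + u p)" "poly_ord 1 (\<lambda>p. snd p + v p)"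
      using uv k poly_ord_fst poly_ord_snd by (auto intro!: poly_ord.add elim: poly_ord_mono)
    have "partial_x fst p = 1" "partial_y fst p = 0" "partial_x snd p = 0" "partial_y snd p = 1" for p
      by (simp_all add: partial_x_def partial_y_def split: prod.split)
    \<comment> \<open>These derivatives have order \<open>k - 1 \<ge> 1\<close>, so the Jacobian of
      \<open>\<tau>\<close> at the origin is the identity.\<close>
    moreover have "partial_x u 0 = 0" "partial_y u 0 = 0" "partial_x v 0 = 0" "partial_y v 0 = 0"
      using poly_ord_partial[OF uv(1)] poly_ord_partial[OF uv(2)] k
      by (auto intro: poly_ord_at_0[of "k - 1"])
    ultimately show "partial_x (\<lambda>p. fst p + u p) 0 * partial_y (\<lambda>p. snd p + v p) 0 -
        partial_y (\<lambda>p. fst p + u p) 0 * partial_x (\<lambda>p. snd p + v p) 0 \<noteq> 0"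
      by (simp add: partial_add[OF poly_ord_fst uv(1)] partial_add[OF poly_ord_snd uv(2)])
  qed
  \<comment> \<open>The germ required by \<open>R_equivalent\<close> is \<open>h + r\<close>: it is
    \<open>h + \<rho>\<close> in the new coordinates, and \<open>r\<close> is too flat to affect the
    jet.\<close>
  then have "right_equivalent (\<lambda>p. h p + \<rho> p) (\<lambda>p. h p + r p)"
    using smooth by (auto simp: right_equivalent_def comp intro!: exI[of _ \<tau>])
  moreover have "jet (n - 1 + k) (\<lambda>p. h p + r p) = jet (n - 1 + k) h"
    by (rule jet_add_higher_order[OF ph r]) (use k in simp)
  ultimately show ?thesis
    using smooth by (auto simp: R_equivalent_def)
qed

theorem corollary3:
  fixes h7 :: "real \<times> real \<Rightarrow> real"
  assumes "homogeneous_polynomial 7 h7"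
    and "h7 \<noteq> (\<lambda>_. 0)"
    and "harmonic h7"
  shows "(\<forall>\<rho>8. homogeneous_polynomial 8 \<rho>8 \<and> polyharmonic 3 \<rho>8 \<longrightarrow>
            R_equivalent 8 (\<lambda>p. h7 p + \<rho>8 p) h7) \<and>
         (\<forall>\<rho>9. homogeneous_polynomial 9 \<rho>9 \<and> polyharmonic 4 \<rho>9 \<longrightarrow>
            R_equivalent 9 (\<lambda>p. h7 p + \<rho>9 p) h7) \<and>
         (\<forall>\<rho>10. homogeneous_polynomial 10 \<rho>10 \<and> polyharmonic 5 \<rho>10 \<longrightarrow>
            R_equivalent 10 (\<lambda>p. h7 p + \<rho>10 p) h7)"
  using R_equivalent_harmonic_add_polyharmonic[OF assms, of 2]
    R_equivalent_harmonic_add_polyharmonic[OF assms, of 3]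
    R_equivalent_harmonic_add_polyharmonic[OF assms, of 4]
  by simp

end
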